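(* Let $\mathrm{Gr}_q\subset\mathrm{SL}_q(4|2)$ be the quantum super Grassmannian, i.e. the subalgebra generated by the elements $D_{ij}$ ($1\le i<j\le4$), $D_{in}$ ($1\le i\le4$, $n=5,6$), $D_{55},D_{66},D_{56}$. The restriction to $\mathrm{Gr}_q$ of the comultiplication $$\Delta:\mathrm{SL}_q(4|2)\to\mathrm{SL}_q(4|2)\otimes\mathrm{SL}_q(4|2),\qquad \Delta(a_{ij})=\sum_{k=1}^6a_{ik}\otimes a_{kj},$$ is of the form $$\Delta:\mathrm{Gr}_q\to\mathrm{SL}_q(4|2)\otimes\mathrm{Gr}_q .$$
   Context: $\mathbb{C}_q=\mathbb{C}[q,q^{-1}]$; tensor products are over $\mathbb{C}_q$, with the super multiplication $(x\otimes y)(z\otimes w)=(-1)^{|y||z|}xz\otimes yw$. The quantum matrix superalgebra $\mathrm{M}_q(4|2)$ is the quotient of the free $\mathbb{C}_q$-superalgebra on generators $a_{ij}$, $1\le i,j\le6$, where $a_{ij}$ has parity $\pi(a_{ij})=p(i)+p(j)\bmod 2$ with $p(i)=0$ for $i\le4$ and $p(i)=1$ for $i=5,6$, by $a_{ij}^2=0$ for $a_{ij}$ odd and the Manin relations $$a_{ij}a_{il}=(-1)^{\pi(a_{ij})\pi(a_{il})}q^{(-1)^{p(i)+1}}a_{il}a_{ij}\quad (j<l),$$ $$a_{ij}a_{kj}=(-1)^{\pi(a_{ij})\pi(a_{kj})}q^{(-1)^{p(j)+1}}a_{kj}a_{ij}\quad (i<k),$$ $$a_{ij}a_{kl}=(-1)^{\pi(a_{ij})\pi(a_{kl})}a_{kl}a_{ij}\quad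 (i<k,\ j>l\ \text{ or }\ i>k,\ j<l),$$ $$a_{ij}a_{kl}-(-1)^{\pi(a_{ij})\pi(a_{kl})}a_{kl}a_{ij}=(-1)^{p(i)p(j)+p(i)p(k)+p(j)p(k)}(q^{-1}-q)a_{kj}a_{il}\quad (i<k,\ j<l).$$ It is a super bialgebra with $\Delta(a_{ij})=\sum_k a_{ik}\otimes a_{kj}$, $\varepsilon(a_{ij})=\delta_{ij}$. Let $\mathcal D_1=\sum_{\sigma\in S_4}(-q)^{-\ell(\sigma)}a_{1\sigma(1)}\cdots a_{4\sigma(4)}$ and $\mathcal D_2=a_{55}a_{66}-q\,a_{56}a_{65}$ be the quantum determinants of the diagonal blocks. Inverting them gives the Hopf superalgebra $\mathrm{GL}_q(4|2)$, with antipode $S$. The quantum Berezinian is $\mathrm{Ber}_q=\mathcal D_1\,S(\mathcal D_2)$, and $\mathrm{SL}_q(4|2)$ is the Hopf superalgebra obtained by setting $\mathrm{Ber}_q=1$. The elements $D$ of $\mathrm{SL}_q(4|2)$ are $$D_{ij}=a_{i1}a_{j2}-q^{-1}a_{i2}a_{j1}\ (1\le i<j\le4),\qquad D_{in}=a_{i1}a_{n2}-q^{-1}a_{i2}a_{n1}\ (1\le i\le4,\ n=5,6),$$ $$D_{55}=a_{51}a_{52},\qquad D_{66}=a_{61}a_{62},\qquad D_{56}=a_{51}a_{62}-q^{-1}a_{52}a_{61}.$$ *)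

theory Defs
  imports Complex_Main "HOL-Library.Poly_Mapping" "HOL-Combinatorics.Permutations"
begin

section \<open>Superalgebras over the Laurent polynomials\<close>

text \<open>The Laurent polynomial ring in \<open>q\<close> over the complex numbers, as the group algebra of the
  additive group of integers; \<open>qpow k\<close> is \<open>q\<^sup>k\<close>.\<close>

type_synonym laurent = "int \<Rightarrow>\<^sub>0 complex"

definition qpow :: "int \<Rightarrow> laurent"
  where "qpow k = Poly_Mapping.single k 1"

class cq_module = ab_group_add +
  fixes scale :: "laurent \<Rightarrow> 'a \<Rightarrow> 'a"  (infixr \<open>*\<^sub>q\<close> 75)
  assumes scale_right_distrib: "r *\<^sub>q (x + y) = r *\<^sub>q x + r *\<^sub>q y"
    and scale_left_distrib: "(r + r') *\<^sub>q x = r *\<^sub>q x + r' *\<^sub>q x"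
    and scale_scale: "r *\<^sub>q (r' *\<^sub>q x) = (r * r') *\<^sub>q x"
    and scale_one: "1 *\<^sub>q x = x"

global_interpretation cq: module "scale :: laurent \<Rightarrow> 'a::cq_module \<Rightarrow> 'a"
  defines cq_span = cq.span
  by unfold_locales
    (simp_all add: scale_right_distrib scale_left_distrib scale_scale scale_one)

text \<open>Parities are Booleans, \<open>True\<close> being odd, so that parities add by \<open>(\<noteq>)\<close>.
  \<open>hcomp s\<close> is the projection to the homogeneous component of parity \<open>s\<close>.
  The base is \<^class>\<open>ring\<close> with \<^class>\<open>monoid_mult\<close> rather than \<^class>\<open>ring_1\<close>, since
  the latter excludes the zero ring and so would not be closed under tensor products.\<close>

class superalgebra = cq_module + ring + monoid_mult +
  fixes hcomp :: "bool \<Rightarrow> 'a \<Rightarrow> 'a"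
  assumes scale_mult_left: "(r *\<^sub>q x) * y = r *\<^sub>q (x * y)"
    and scale_mult_right: "x * (r *\<^sub>q y) = r *\<^sub>q (x * y)"
    and hcomp_add: "hcomp s (x + y) = hcomp s x + hcomp s y"
    and hcomp_scale: "hcomp s (r *\<^sub>q x) = r *\<^sub>q hcomp s x"
    and hcomp_hcomp: "hcomp s (hcomp t x) = (if s = t then hcomp t x else 0)"
    and hcomp_sum: "hcomp False x + hcomp True x = x"
    and hcomp_one: "hcomp False 1 = 1"
    and hcomp_mult: "hcomp (s \<noteq> t) (hcomp s x * hcomp t y) = hcomp s x * hcomp t y"

definition homogeneous :: "bool \<Rightarrow> 'a::superalgebra \<Rightarrow> bool"
  where "homogeneous s x \<longleftrightarrow> hcomp s x = x"

definition koszul :: "bool \<Rightarrow> bool \<Rightarrow> laurent"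
  where "koszul s t = (if s \<and> t then - 1 else 1)"

definition superalgebra_hom :: "('a::superalgebra \<Rightarrow> 'b::superalgebra) \<Rightarrow> bool"
  where "superalgebra_hom f \<longleftrightarrow>
    (\<forall>x y. f (x + y) = f x + f y) \<and> (\<forall>r x. f (r *\<^sub>q x) = r *\<^sub>q f x) \<and>
    (\<forall>x y. f (x * y) = f x * f y) \<and> f 1 = 1 \<and> (\<forall>s x. f (hcomp s x) = hcomp s (f x))"

definition subalgebra :: "'a::superalgebra set \<Rightarrow> bool"
  where "subalgebra B \<longleftrightarrow> 1 \<in> B \<and> (\<forall>x\<in>B. \<forall>y\<in>B. x + y \<in> B) \<and>
    (\<forall>r. \<forall>x\<in>B. r *\<^sub>q x \<in> B) \<and> (\<forall>x\<in>B. \<forall>y\<in>B. x * y \<in> B)"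

definition generated_subalgebra :: "'a::superalgebra set \<Rightarrow> 'a set"
  where "generated_subalgebra X = subalgebra hull X"

lemma hcomp_zero [simp]: "hcomp s (0 :: 'a::superalgebra) = 0"
  using hcomp_add[of s 0 0] by simp

lemma homogeneous_hcomp [simp]: "homogeneous s (hcomp s x)"
  by (simp add: homogeneous_def hcomp_hcomp)

lemma homogeneous_other: "homogeneous s x \<Longrightarrow> hcomp t x = (if s = t then x else 0)"
  by (metis hcomp_hcomp homogeneous_def)

lemma homogeneous_one [simp]: "homogeneous False 1"
  by (simp add: homogeneous_def hcomp_one)

lemma homogeneous_mult:
  "homogeneous s x \<Longrightarrow> homogeneous t y \<Longrightarrow> homogeneous (s \<noteq> t) (x * y)"
  by (metis hcomp_mult homogeneous_def)


section \<open>Two-sided ideals\<close>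

inductive_set ideal_gen :: "'a::{ring, monoid_mult} set \<Rightarrow> 'a set" for R :: "'a set"
  where
    base: "x \<in> R \<Longrightarrow> x \<in> ideal_gen R"
  | zero: "0 \<in> ideal_gen R"
  | add: "x \<in> ideal_gen R \<Longrightarrow> y \<in> ideal_gen R \<Longrightarrow> x + y \<in> ideal_gen R"
  | left: "x \<in> ideal_gen R \<Longrightarrow> a * x \<in> ideal_gen R"
  | right: "x \<in> ideal_gen R \<Longrightarrow> x * a \<in> ideal_gen R"

lemma ideal_gen_uminus: "x \<in> ideal_gen R \<Longrightarrow> - x \<in> ideal_gen R"
  using ideal_gen.left[of x R "- 1"] by simp

lemma ideal_gen_diff: "x \<in> ideal_gen R \<Longrightarrow> y \<in> ideal_gen R \<Longrightarrow> x - y \<in> ideal_gen R"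
  using ideal_gen.add[OF _ ideal_gen_uminus] by fastforce

lemma ideal_gen_equivp: "equivp (\<lambda>x y. x - y \<in> ideal_gen R)"
proof (rule equivpI)
  show "reflp (\<lambda>x y. x - y \<in> ideal_gen R)"
    by (simp add: reflp_def ideal_gen.zero)
  show "symp (\<lambda>x y. x - y \<in> ideal_gen R)"
    by (metis (mono_tags, lifting) sympI ideal_gen_uminus minus_diff_eq)
  show "transp (\<lambda>x y. x - y \<in> ideal_gen R)"
  proof (rule transpI)
    fix x y z assume "x - y \<in> ideal_gen R" "y - z \<in> ideal_gen R"
    from ideal_gen.add[OF this] show "x - z \<in> ideal_gen R" by simp
  qed
qed

lemma ideal_gen_cong_add:
  assumes "x - x' \<in> ideal_gen R" "y - y' \<in> ideal_gen R"
  shows "(x + y) - (x' + y') \<in> ideal_gen R"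
  using ideal_gen.add[OF assms] by (simp add: algebra_simps)

lemma ideal_gen_cong_diff:
  assumes "x - x' \<in> ideal_gen R" "y - y' \<in> ideal_gen R"
  shows "(x - y) - (x' - y') \<in> ideal_gen R"
  using ideal_gen_diff[OF assms] by (simp add: algebra_simps)

lemma ideal_gen_cong_uminus:
  assumes "x - x' \<in> ideal_gen R"
  shows "(- x) - (- x') \<in> ideal_gen R"
  using ideal_gen_uminus[OF assms] by (simp add: algebra_simps)

lemma ideal_gen_cong_mult:
  assumes "x - x' \<in> ideal_gen R" "y - y' \<in> ideal_gen R"
  shows "x * y - x' * y' \<in> ideal_gen R"
proof -
  have "(x - x') * y + x' * (y - y') \<in> ideal_gen R"
    using assms by (intro ideal_gen.add ideal_gen.left ideal_gen.right)
  then show ?thesis by (simp add: algebra_simps)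
qed

lemma ideal_gen_graded:
  fixes h :: "bool \<Rightarrow> 'a::{ring, monoid_mult} \<Rightarrow> 'a"
  assumes add: "\<And>s x y. h s (x + y) = h s x + h s y"
    and mult: "\<And>s x y. h s (x * y) = h False x * h s y + h True x * h (\<not> s) y"
    and R: "\<And>s x. x \<in> R \<Longrightarrow> h s x \<in> ideal_gen R"
    and x: "x \<in> ideal_gen R"
  shows "h s x \<in> ideal_gen R"
  using x
proof (induction arbitrary: s)
  case zero
  have "h s 0 = 0" using add[of s 0 0] by simp
  then show ?case by (simp add: ideal_gen.zero)
qed (auto simp: add mult intro: R ideal_gen.intros)


section \<open>Tensor products\<close>

text \<open>The tensor product is the free module on the pairs modulo the bilinearity relations.\<close>

abbreviation (input) fscale :: "laurent \<Rightarrow> ('b \<Rightarrow>\<^sub>0 laurent) \<Rightarrow> ('b \<Rightarrow>\<^sub>0 laurent)"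
  where "fscale r f \<equiv> Poly_Mapping.map ((*) r) f"

inductive_set tensor_ker :: "('a::cq_module \<times> 'b::cq_module \<Rightarrow>\<^sub>0 laurent) set"
  where
    "0 \<in> tensor_ker"
  | "f \<in> tensor_ker \<Longrightarrow> g \<in> tensor_ker \<Longrightarrow> f + g \<in> tensor_ker"
  | "f \<in> tensor_ker \<Longrightarrow> fscale r f \<in> tensor_ker"
  | "Poly_Mapping.single (x + x', y) 1
      - (Poly_Mapping.single (x, y) 1 + Poly_Mapping.single (x', y) 1) \<in> tensor_ker"
  | "Poly_Mapping.single (x, y + y') 1
      - (Poly_Mapping.single (x, y) 1 + Poly_Mapping.single (x, y') 1) \<in> tensor_ker"
  | "Poly_Mapping.single (r *\<^sub>q x, y) 1 - Poly_Mapping.single (x, y) r \<in> tensor_ker"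
  | "Poly_Mapping.single (x, r *\<^sub>q y) 1 - Poly_Mapping.single (x, y) r \<in> tensor_ker"

lemma lookup_fscale: "Poly_Mapping.lookup (fscale r f) k = r * Poly_Mapping.lookup f k"
  by (simp add: Poly_Mapping.map.rep_eq when_def)

lemma fscale_add: "fscale r (f + g) = fscale r f + fscale r g"
  by (rule poly_mapping_eqI) (simp add: lookup_fscale lookup_add algebra_simps)

lemma fscale_diff: "fscale r (f - g) = fscale r f - fscale r g"
  by (rule poly_mapping_eqI) (simp add: lookup_fscale lookup_minus algebra_simps)

lemma fscale_minus_one: "fscale (- 1) f = - f"
  by (rule poly_mapping_eqI) (simp add: lookup_fscale)

lemma fscale_add_left: "fscale (r + r') f = fscale r f + fscale r' f"
  by (rule poly_mapping_eqI) (simp add: lookup_fscale lookup_add algebra_simps)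

lemma fscale_fscale: "fscale r (fscale r' f) = fscale (r * r') f"
  by (rule poly_mapping_eqI) (simp add: lookup_fscale algebra_simps)

lemma fscale_one: "fscale 1 f = f"
  by (rule poly_mapping_eqI) (simp add: lookup_fscale)

lemma fscale_single: "fscale r (Poly_Mapping.single k c) = Poly_Mapping.single k (r * c)"
  by (rule poly_mapping_eqI) (simp add: lookup_fscale lookup_single when_def)

lemma tensor_ker_uminus: "f \<in> tensor_ker \<Longrightarrow> - f \<in> tensor_ker"
  using tensor_ker.intros(3)[of f "- 1"] by (simp only: fscale_minus_one)

quotient_type (overloaded) ('a, 'b) tensor = "'a::cq_module \<times> 'b::cq_module \<Rightarrow>\<^sub>0 laurent" /
  "\<lambda>f g. f - g \<in> tensor_ker"
proof (rule equivpI)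
  show "reflp (\<lambda>f g :: 'a \<times> 'b \<Rightarrow>\<^sub>0 laurent. f - g \<in> tensor_ker)"
    by (simp add: reflp_def tensor_ker.intros)
  show "symp (\<lambda>f g :: 'a \<times> 'b \<Rightarrow>\<^sub>0 laurent. f - g \<in> tensor_ker)"
    by (metis (mono_tags, lifting) sympI tensor_ker_uminus minus_diff_eq)
  show "transp (\<lambda>f g :: 'a \<times> 'b \<Rightarrow>\<^sub>0 laurent. f - g \<in> tensor_ker)"
  proof (rule transpI)
    fix x y z :: "'a \<times> 'b \<Rightarrow>\<^sub>0 laurent" assume "x - y \<in> tensor_ker" "y - z \<in> tensor_ker"
    from tensor_ker.intros(2)[OF this] show "x - z \<in> tensor_ker" by simp
  qed
qed

lift_definition pure_tensor :: "'a::cq_module \<Rightarrow> 'b::cq_module \<Rightarrow> ('a, 'b) tensor"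
  (infixl \<open>\<otimes>\<close> 72) is "\<lambda>x y. Poly_Mapping.single (x, y) 1" .

instantiation tensor :: (cq_module, cq_module) cq_module
begin

lift_definition zero_tensor :: "('a, 'b) tensor" is 0 .

lift_definition plus_tensor :: "('a, 'b) tensor \<Rightarrow> ('a, 'b) tensor \<Rightarrow> ('a, 'b) tensor" is "(+)"
  using tensor_ker.intros(2) by (metis (no_types, lifting) add_diff_add)

lift_definition uminus_tensor :: "('a, 'b) tensor \<Rightarrow> ('a, 'b) tensor" is uminus
  by (metis minus_diff_minus tensor_ker_uminus)

lift_definition minus_tensor :: "('a, 'b) tensor \<Rightarrow> ('a, 'b) tensor \<Rightarrow> ('a, 'b) tensor" is "(-)"
proof -
  fix f f' g g' :: "'a \<times> 'b \<Rightarrow>\<^sub>0 laurent"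
  assume "f - f' \<in> tensor_ker" "g - g' \<in> tensor_ker"
  from tensor_ker.intros(2)[OF this(1) tensor_ker_uminus[OF this(2)]]
  show "f - g - (f' - g') \<in> tensor_ker" by (simp add: algebra_simps)
qed

lift_definition scale_tensor :: "laurent \<Rightarrow> ('a, 'b) tensor \<Rightarrow> ('a, 'b) tensor" is fscale
  by (metis fscale_diff tensor_ker.intros(3))

instance
  by standard
    (transfer; simp add: algebra_simps tensor_ker.intros(1) fscale_add fscale_add_left
      fscale_fscale fscale_one)+

end

lemma pure_tensor_add_left: "(x + x') \<otimes> y = x \<otimes> y + x' \<otimes> y"
  by transfer (rule tensor_ker.intros)

lemma pure_tensor_add_right: "x \<otimes> (y + y') = x \<otimes> y + x \<otimes> y'"
  by transfer (rule tensor_ker.intros)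

lemma pure_tensor_scale_left: "(r *\<^sub>q x) \<otimes> y = r *\<^sub>q (x \<otimes> y)"
  by transfer (simp add: fscale_single tensor_ker.intros)

lemma pure_tensor_scale_right: "x \<otimes> (r *\<^sub>q y) = r *\<^sub>q (x \<otimes> y)"
  by transfer (simp add: fscale_single tensor_ker.intros)

lemma pure_tensor_zero [simp]: "0 \<otimes> y = 0" "x \<otimes> 0 = 0"
  using pure_tensor_add_left[of 0 0 y] pure_tensor_add_right[of x 0 0] by auto

lemma poly_mapping_additive_induct [case_names single add]:
  assumes single: "\<And>k c. P (Poly_Mapping.single k c)"
    and add: "\<And>f g. P f \<Longrightarrow> P g \<Longrightarrow> P (f + g)"
  shows "P (f :: 'k \<Rightarrow>\<^sub>0 'c::comm_monoid_add)"
proof (induction f rule: Poly_Mapping.update_induct)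
  case const
  then show ?case using single[of undefined 0] by simp
next
  case (update f k c)
  then have "Poly_Mapping.update k c f = f + Poly_Mapping.single k c"
    by (intro poly_mapping_eqI)
      (auto simp: lookup_update lookup_add lookup_single when_def not_in_keys_iff_lookup_eq_zero)
  then show ?case using update.IH add single by simp
qed

lemma tensor_induct [case_names pure add]:
  assumes pure: "\<And>x y. P (x \<otimes> y)" and add: "\<And>t u. P t \<Longrightarrow> P u \<Longrightarrow> P (t + u)"
  shows "P t"
proof -
  have "P (abs_tensor f)" for f
  proof (induction f rule: poly_mapping_additive_induct)
    case (single k r)
    have "abs_tensor (Poly_Mapping.single k r) = r *\<^sub>q (fst k \<otimes> snd k)"
      by (simp add: pure_tensor.abs_eq scale_tensor.abs_eq fscale_single)
    then show ?case using pure[of "r *\<^sub>q fst k" "snd k"] by (simp add: pure_tensor_scale_left)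
  next
    case (add f g)
    then show ?case using assms(2)[OF add.IH] by (simp add: plus_tensor.abs_eq)
  qed
  from this[of "rep_tensor t"] show ?thesis by (simp add: Quotient3_abs_rep[OF Quotient3_tensor])
qed


definition bilinear_map :: "('a::cq_module \<Rightarrow> 'b::cq_module \<Rightarrow> 'c::cq_module) \<Rightarrow> bool"
  where "bilinear_map \<phi> \<longleftrightarrow>
    (\<forall>x x' y. \<phi> (x + x') y = \<phi> x y + \<phi> x' y) \<and> (\<forall>x y y'. \<phi> x (y + y') = \<phi> x y + \<phi> x y') \<and>
    (\<forall>r x y. \<phi> (r *\<^sub>q x) y = r *\<^sub>q \<phi> x y) \<and> (\<forall>r x y. \<phi> x (r *\<^sub>q y) = r *\<^sub>q \<phi> x y)"

definition free_lift ::
    "('a \<Rightarrow> 'b \<Rightarrow> 'c::cq_module) \<Rightarrow> ('a \<times> 'b \<Rightarrow>\<^sub>0 laurent) \<Rightarrow> 'c"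
  where "free_lift \<phi> f =
    (\<Sum>k\<in>Poly_Mapping.keys f. Poly_Mapping.lookup f k *\<^sub>q \<phi> (fst k) (snd k))"

text \<open>The linear map on the tensor product induced by a bilinear map; meaningful only for
  \<open>bilinear_map \<phi>\<close>, see \<open>tensor_lift_pure\<close>.\<close>

definition tensor_lift ::
    "('a::cq_module \<Rightarrow> 'b::cq_module \<Rightarrow> 'c::cq_module) \<Rightarrow> ('a, 'b) tensor \<Rightarrow> 'c"
  where "tensor_lift \<phi> t = free_lift \<phi> (rep_tensor t)"

lemma free_lift_superset:
  assumes "finite A" "Poly_Mapping.keys f \<subseteq> A"
  shows "free_lift \<phi> f = (\<Sum>k\<in>A. Poly_Mapping.lookup f k *\<^sub>q \<phi> (fst k) (snd k))"
  unfolding free_lift_def using assms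
  by (intro sum.mono_neutral_left) (auto simp: in_keys_iff)

lemma free_lift_add: "free_lift \<phi> (f + g) = free_lift \<phi> f + free_lift \<phi> g"
proof -
  let ?A = "Poly_Mapping.keys f \<union> Poly_Mapping.keys g"
  have "Poly_Mapping.keys (f + g) \<subseteq> ?A" by (rule keys_add)
  then show ?thesis
    by (simp add: free_lift_superset[of ?A] lookup_add scale_left_distrib sum.distrib)
qed

lemma free_lift_fscale: "free_lift \<phi> (fscale r f) = r *\<^sub>q free_lift \<phi> f"
proof -
  have "Poly_Mapping.keys (fscale r f) \<subseteq> Poly_Mapping.keys f"
    by (auto simp: in_keys_iff lookup_fscale)
  then show ?thesis
    by (simp add: free_lift_superset[of "Poly_Mapping.keys f"] lookup_fscale cq.scale_sum_right)
qed

lemma free_lift_single: "free_lift \<phi> (Poly_Mapping.single (x, y) r) = r *\<^sub>q \<phi> x y"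
  by (simp add: free_lift_superset[of "{(x, y)}"])

lemma free_lift_diff: "free_lift \<phi> (f - g) = free_lift \<phi> f - free_lift \<phi> g"
  using free_lift_add[of \<phi> "f - g" g] by simp

lemma free_lift_tensor_ker:
  assumes "bilinear_map \<phi>" "f \<in> tensor_ker"
  shows "free_lift \<phi> f = 0"
  using assms(2)
proof (induction)
  case 1
  then show ?case by (simp add: free_lift_def)
qed (use assms(1) in \<open>simp_all add: bilinear_map_def free_lift_add free_lift_diff
      free_lift_fscale free_lift_single\<close>)

lemma tensor_lift_abs:
  assumes "bilinear_map \<phi>"
  shows "tensor_lift \<phi> (abs_tensor f) = free_lift \<phi> f"
proof -
  have "rep_tensor (abs_tensor f) - f \<in> tensor_ker"
    using Quotient3_rep_abs[OF Quotient3_tensor, of f] by (simp add: tensor_ker.intros(1))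
  from free_lift_tensor_ker[OF assms this] show ?thesis
    by (simp add: tensor_lift_def free_lift_diff)
qed

lemma tensor_lift_pure: "bilinear_map \<phi> \<Longrightarrow> tensor_lift \<phi> (x \<otimes> y) = \<phi> x y"
  by (simp add: pure_tensor.abs_eq tensor_lift_abs free_lift_single)

lemma tensor_abs_cases: obtains f where "t = abs_tensor f"
  using Quotient3_abs_rep[OF Quotient3_tensor, of t] by metis

lemma tensor_lift_add:
  assumes "bilinear_map \<phi>"
  shows "tensor_lift \<phi> (t + u) = tensor_lift \<phi> t + tensor_lift \<phi> u"
  by (rule tensor_abs_cases[of t], rule tensor_abs_cases[of u])
    (simp add: plus_tensor.abs_eq tensor_lift_abs[OF assms] free_lift_add)

lemma tensor_lift_scale:
  assumes "bilinear_map \<phi>"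
  shows "tensor_lift \<phi> (r *\<^sub>q t) = r *\<^sub>q tensor_lift \<phi> t"
  by (rule tensor_abs_cases[of t])
    (simp add: scale_tensor.abs_eq tensor_lift_abs[OF assms] free_lift_fscale)

lemma tensor_lift_pointwise_add:
  "tensor_lift (\<lambda>x y. \<phi> x y + \<psi> x y) t = tensor_lift \<phi> t + tensor_lift \<psi> t"
  by (simp add: tensor_lift_def free_lift_def scale_right_distrib sum.distrib)

lemma tensor_lift_pointwise_scale:
  "tensor_lift (\<lambda>x y. r *\<^sub>q \<phi> x y) t = r *\<^sub>q tensor_lift \<phi> t"
  by (simp add: tensor_lift_def free_lift_def cq.scale_sum_right scale_scale mult.commute)

definition tensor_map ::
    "('a::cq_module \<Rightarrow> 'c::cq_module) \<Rightarrow> ('b::cq_module \<Rightarrow> 'd::cq_module) \<Rightarrow>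
      ('a, 'b) tensor \<Rightarrow> ('c, 'd) tensor"
  where "tensor_map f g = tensor_lift (\<lambda>x y. f x \<otimes> g y)"

definition tensor_assoc ::
    "(('a::cq_module, 'b::cq_module) tensor, 'c::cq_module) tensor \<Rightarrow>
      ('a, ('b, 'c) tensor) tensor"
  where "tensor_assoc = tensor_lift (\<lambda>t z. tensor_lift (\<lambda>x y. x \<otimes> (y \<otimes> z)) t)"

text \<open>The image of \<open>X \<otimes> Y\<close> in the ambient tensor product, for submodules \<open>X\<close> and \<open>Y\<close>.\<close>

definition tensor_subspace ::
    "'a::cq_module set \<Rightarrow> 'b::cq_module set \<Rightarrow> ('a, 'b) tensor set"
  where "tensor_subspace X Y = cq_span {x \<otimes> y | x y. x \<in> X \<and> y \<in> Y}"

text \<open>The super multiplication on the tensor product; on homogeneous elements it is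
  \<open>pure_tensor_mult\<close> below.\<close>

definition tensor_mult_pure ::
    "'a::superalgebra \<Rightarrow> 'b::superalgebra \<Rightarrow> 'a \<Rightarrow> 'b \<Rightarrow> ('a, 'b) tensor"
  where "tensor_mult_pure x y z w =
    (\<Sum>s\<in>UNIV. \<Sum>t\<in>UNIV. koszul s t *\<^sub>q ((x * hcomp t z) \<otimes> (hcomp s y * w)))"

definition hcomp_pure ::
    "bool \<Rightarrow> 'a::superalgebra \<Rightarrow> 'b::superalgebra \<Rightarrow> ('a, 'b) tensor"
  where "hcomp_pure s x y = (\<Sum>t\<in>UNIV. hcomp t x \<otimes> hcomp (s \<noteq> t) y)"

lemmas bilinear_simps = hcomp_add hcomp_scale distrib_left distrib_right scale_mult_left
  scale_mult_right pure_tensor_add_left pure_tensor_add_right pure_tensor_scale_left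
  pure_tensor_scale_right scale_right_distrib scale_left_distrib scale_scale UNIV_bool

lemma bilinear_tensor_mult_pure: "bilinear_map (tensor_mult_pure x y)"
  by (simp add: bilinear_map_def tensor_mult_pure_def bilinear_simps algebra_simps)

lemma bilinear_hcomp: "bilinear_map (hcomp_pure s)"
  by (simp add: bilinear_map_def hcomp_pure_def bilinear_simps algebra_simps)

lemma tensor_mult_pure_left:
  "tensor_mult_pure (x + x') y = (\<lambda>z w. tensor_mult_pure x y z w + tensor_mult_pure x' y z w)"
  "tensor_mult_pure x (y + y') = (\<lambda>z w. tensor_mult_pure x y z w + tensor_mult_pure x y' z w)"
  "tensor_mult_pure (r *\<^sub>q x) y = (\<lambda>z w. r *\<^sub>q tensor_mult_pure x y z w)"
  "tensor_mult_pure x (r *\<^sub>q y) = (\<lambda>z w. r *\<^sub>q tensor_mult_pure x y z w)"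
  by (simp_all add: fun_eq_iff tensor_mult_pure_def bilinear_simps algebra_simps)

instantiation tensor :: (superalgebra, superalgebra) superalgebra
begin

definition one_tensor :: "('a, 'b) tensor" where "1 = (1 \<otimes> 1 :: ('a, 'b) tensor)"

definition times_tensor :: "('a, 'b) tensor \<Rightarrow> ('a, 'b) tensor \<Rightarrow> ('a, 'b) tensor"
  where "t * u = tensor_lift (\<lambda>x y. tensor_lift (tensor_mult_pure x y) u) t"

definition hcomp_tensor :: "bool \<Rightarrow> ('a, 'b) tensor \<Rightarrow> ('a, 'b) tensor"
  where "hcomp s = (tensor_lift (hcomp_pure s) :: ('a, 'b) tensor \<Rightarrow> ('a, 'b) tensor)"

lemma bilinear_times:
  "bilinear_map (\<lambda>(x::'a) (y::'b). tensor_lift (tensor_mult_pure x y) u)"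
  by (simp add: bilinear_map_def tensor_mult_pure_left tensor_lift_pointwise_add
      tensor_lift_pointwise_scale)

lemma times_tensor_add_left: "(t + t') * u = t * u + t' * u" for t t' u :: "('a, 'b) tensor"
  by (simp add: times_tensor_def tensor_lift_add[OF bilinear_times])

lemma times_tensor_add_right: "t * (u + u') = t * u + t * u'" for t u u' :: "('a, 'b) tensor"
  by (simp add: times_tensor_def tensor_lift_add[OF bilinear_tensor_mult_pure]
      tensor_lift_pointwise_add)

lemma times_tensor_scale_left: "(r *\<^sub>q t) * u = r *\<^sub>q (t * u)" for t u :: "('a, 'b) tensor"
  by (simp add: times_tensor_def tensor_lift_scale[OF bilinear_times])

lemma times_tensor_scale_right: "t * (r *\<^sub>q u) = r *\<^sub>q (t * u)" for t u :: "('a, 'b) tensor"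
  by (simp add: times_tensor_def tensor_lift_scale[OF bilinear_tensor_mult_pure]
      tensor_lift_pointwise_scale)

lemma hcomp_tensor_add: "hcomp s (t + u) = hcomp s t + hcomp s u" for t u :: "('a, 'b) tensor"
  by (simp add: hcomp_tensor_def tensor_lift_add[OF bilinear_hcomp])

lemma hcomp_tensor_scale: "hcomp s (r *\<^sub>q t) = r *\<^sub>q hcomp s t" for t :: "('a, 'b) tensor"
  by (simp add: hcomp_tensor_def tensor_lift_scale[OF bilinear_hcomp])

lemma pure_tensor_mult:
  fixes x z :: 'a and y w :: 'b
  assumes "homogeneous s y" "homogeneous t z"
  shows "(x \<otimes> y) * (z \<otimes> w) = koszul s t *\<^sub>q ((x * z) \<otimes> (y * w))"
proof -
  have "(x \<otimes> y) * (z \<otimes> w) = tensor_mult_pure x y z w"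
    unfolding times_tensor_def
    by (rule trans[OF tensor_lift_pure[OF bilinear_times]
          tensor_lift_pure[OF bilinear_tensor_mult_pure]])
  then show ?thesis
    by (cases s; cases t)
      (simp_all add: tensor_mult_pure_def koszul_def UNIV_bool homogeneous_other[OF assms(1)]
        homogeneous_other[OF assms(2)])
qed

lemma hcomp_pure_tensor:
  fixes x :: 'a and y :: 'b
  assumes "homogeneous s x" "homogeneous t y"
  shows "hcomp p (x \<otimes> y) = (if p = (s \<noteq> t) then x \<otimes> y else 0)"
  by (cases s; cases t; cases p)
    (simp_all add: hcomp_tensor_def tensor_lift_pure bilinear_hcomp
      hcomp_pure_def UNIV_bool homogeneous_other[OF assms(1)] homogeneous_other[OF assms(2)])

lemma tensor_homogeneous_induct [case_names pure add]:
  fixes t :: "('a, 'b) tensor"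
  assumes pure: "\<And>s s' (x::'a) (y::'b). homogeneous s x \<Longrightarrow> homogeneous s' y \<Longrightarrow> P (x \<otimes> y)"
    and add: "\<And>t u. P t \<Longrightarrow> P u \<Longrightarrow> P (t + u)"
  shows "P t"
proof (induction t rule: tensor_induct)
  case (pure x y)
  have "P ((hcomp False x + hcomp True x) \<otimes> (hcomp False y + hcomp True y))"
    unfolding pure_tensor_add_left pure_tensor_add_right
    by (intro add assms(1)[OF homogeneous_hcomp homogeneous_hcomp])
  then show ?case by (simp only: hcomp_sum)
next
  case (add t u)
  then show ?case by (rule assms(2))
qed

lemma koszul_simps [simp]:
  "koszul False t = 1" "koszul s False = 1" "koszul True True = - 1"
  by (simp_all add: koszul_def)

lemma times_tensor_assoc: "(t * u) * v = t * (u * v)" for t u v :: "('a, 'b) tensor"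
proof (induction t rule: tensor_homogeneous_induct)
  case (add t t')
  then show ?case by (simp add: times_tensor_add_left)
next
  case t: (pure s1 s2 x y)
  show ?case
  proof (induction u rule: tensor_homogeneous_induct)
    case (add u u')
    then show ?case by (simp add: times_tensor_add_left times_tensor_add_right)
  next
    case u: (pure t1 t2 z w)
    show ?case
    proof (induction v rule: tensor_homogeneous_induct)
      case (add v v')
      then show ?case by (simp add: times_tensor_add_right)
    next
      case v: (pure u1 u2 a b)
      have 1: "homogeneous (s2 \<noteq> t2) (y * w)" by (rule homogeneous_mult[OF t(2) u(2)])
      have 2: "homogeneous (t1 \<noteq> u1) (z * a)" by (rule homogeneous_mult[OF u(1) v(1)])
      have "koszul s2 t1 * koszul (s2 \<noteq> t2) u1 = koszul t2 u1 * koszul s2 (t1 \<noteq> u1)"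
        by (auto simp: koszul_def)
      then show ?case
        by (simp add: pure_tensor_mult[OF t(2) u(1)] pure_tensor_mult[OF u(2) v(1)]
            pure_tensor_mult[OF 1 v(1)] pure_tensor_mult[OF t(2) 2]
            times_tensor_scale_left times_tensor_scale_right scale_scale mult.assoc)
    qed
  qed
qed

instance
proof
  fix t u v :: "('a, 'b) tensor" and r :: laurent and p p' :: bool
  show "t * u * v = t * (u * v)" by (rule times_tensor_assoc)
  show "(t + u) * v = t * v + u * v" by (rule times_tensor_add_left)
  show "t * (u + v) = t * u + t * v" by (rule times_tensor_add_right)
  show "1 * t = t"
  proof (induction t rule: tensor_homogeneous_induct)
    case (pure s s' x y)
    then show ?case using pure_tensor_mult[OF homogeneous_one pure(1)]
      by (simp add: one_tensor_def scale_one)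
  qed (simp add: times_tensor_add_right)
  show "t * 1 = t"
  proof (induction t rule: tensor_homogeneous_induct)
    case (pure s s' x y)
    then show ?case using pure_tensor_mult[OF pure(2) homogeneous_one]
      by (simp add: one_tensor_def scale_one)
  qed (simp add: times_tensor_add_left)
  show "(r *\<^sub>q t) * u = r *\<^sub>q (t * u)" by (rule times_tensor_scale_left)
  show "t * (r *\<^sub>q u) = r *\<^sub>q (t * u)" by (rule times_tensor_scale_right)
  show "hcomp p (t + u) = hcomp p t + hcomp p u" by (rule hcomp_tensor_add)
  show "hcomp p (r *\<^sub>q t) = r *\<^sub>q hcomp p t" by (rule hcomp_tensor_scale)
  have hcomp0: "hcomp p (0 :: ('a, 'b) tensor) = 0" for p
    using hcomp_tensor_add[of p 0 0] by simp
  show "hcomp p (hcomp p' t) = (if p = p' then hcomp p' t else 0)"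
    by (induction t rule: tensor_homogeneous_induct)
      (auto simp: hcomp_pure_tensor hcomp_tensor_add hcomp0)
  show "hcomp False t + hcomp True t = t"
    by (induction t rule: tensor_homogeneous_induct)
      (auto simp: hcomp_pure_tensor hcomp_tensor_add algebra_simps)
  show "hcomp False (1 :: ('a, 'b) tensor) = 1"
    by (simp add: one_tensor_def hcomp_pure_tensor[OF homogeneous_one homogeneous_one])
  have times0: "t * 0 = 0" "0 * t = 0" for t :: "('a, 'b) tensor"
    using times_tensor_add_right[of t 0 0] times_tensor_add_left[of 0 0 t] by simp_all
  show "hcomp (p \<noteq> p') (hcomp p t * hcomp p' u) = hcomp p t * hcomp p' u"
  proof (induction t rule: tensor_homogeneous_induct)
    case (add t t')
    then show ?case by (simp add: times_tensor_add_left hcomp_tensor_add)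
  next
    case t: (pure s s' x y)
    show ?case
    proof (induction u rule: tensor_homogeneous_induct)
      case (add u u')
      then show ?case by (simp add: times_tensor_add_right hcomp_tensor_add)
    next
      case u: (pure r r' z w)
      have 1: "homogeneous (s \<noteq> r) (x * z)" by (rule homogeneous_mult[OF t(1) u(1)])
      have 2: "homogeneous (s' \<noteq> r') (y * w)" by (rule homogeneous_mult[OF t(2) u(2)])
      show ?case
        by (auto simp: hcomp_pure_tensor[OF t] hcomp_pure_tensor[OF u] times0 hcomp0
            pure_tensor_mult[OF t(2) u(1)] hcomp_tensor_scale hcomp_pure_tensor[OF 1 2])
    qed
  qed
qed

end


section \<open>Hopf superalgebras\<close>

definition superalgebra_character :: "('a::superalgebra \<Rightarrow> laurent) \<Rightarrow> bool"
  where "superalgebra_character \<epsilon> \<longleftrightarrow>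
    (\<forall>x y. \<epsilon> (x + y) = \<epsilon> x + \<epsilon> y) \<and> (\<forall>r x. \<epsilon> (r *\<^sub>q x) = r * \<epsilon> x) \<and>
    (\<forall>x y. \<epsilon> (x * y) = \<epsilon> x * \<epsilon> y) \<and> \<epsilon> 1 = 1 \<and> (\<forall>x. \<epsilon> (hcomp True x) = 0)"

definition hopf_superalgebra ::
    "('a::superalgebra \<Rightarrow> ('a, 'a) tensor) \<Rightarrow> ('a \<Rightarrow> laurent) \<Rightarrow> ('a \<Rightarrow> 'a) \<Rightarrow> bool"
  where "hopf_superalgebra \<Delta> \<epsilon> S \<longleftrightarrow>
    superalgebra_hom \<Delta> \<and> superalgebra_character \<epsilon> \<and>
    (\<forall>x. tensor_assoc (tensor_map \<Delta> id (\<Delta> x)) = tensor_map id \<Delta> (\<Delta> x)) \<and>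
    (\<forall>x. tensor_lift (\<lambda>y z. \<epsilon> y *\<^sub>q z) (\<Delta> x) = x) \<and>
    (\<forall>x. tensor_lift (\<lambda>y z. \<epsilon> z *\<^sub>q y) (\<Delta> x) = x) \<and>
    (\<forall>x y. S (x + y) = S x + S y) \<and> (\<forall>r x. S (r *\<^sub>q x) = r *\<^sub>q S x) \<and>
    (\<forall>s x. S (hcomp s x) = hcomp s (S x)) \<and>
    (\<forall>x. tensor_lift (\<lambda>y z. S y * z) (\<Delta> x) = \<epsilon> x *\<^sub>q 1) \<and>
    (\<forall>x. tensor_lift (\<lambda>y z. y * S z) (\<Delta> x) = \<epsilon> x *\<^sub>q 1)"


section \<open>The free superalgebra\<close>

typedef index = "{1..6::nat}" morphisms index_val Index by auto

text \<open>The generators of \<open>GL\<^sub>q(4|2)\<close>: the matrix entries and the inverses of the two quantum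
  determinants.\<close>

datatype gen = Entry index index | Inv_D1 | Inv_D2

definition par :: "nat \<Rightarrow> nat"
  where "par i = (if i \<le> 4 then 0 else 1)"

definition entry_par :: "nat \<Rightarrow> nat \<Rightarrow> nat"
  where "entry_par i j = (par i + par j) mod 2"

fun gen_odd :: "gen \<Rightarrow> bool"
  where
    "gen_odd (Entry i j) = odd (entry_par (index_val i) (index_val j))"
  | "gen_odd Inv_D1 = False"
  | "gen_odd Inv_D2 = False"

typedef gen_monoid = "UNIV :: gen list set" morphisms letters Monomial by simp

setup_lifting type_definition_gen_monoid

instantiation gen_monoid :: monoid_add
begin
lift_definition zero_gen_monoid :: gen_monoid is "[]" .
lift_definition plus_gen_monoid :: "gen_monoid \<Rightarrow> gen_monoid \<Rightarrow> gen_monoid" is "(@)" .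
instance by standard (transfer; simp)+
end

type_synonym free_alg = "gen_monoid \<Rightarrow>\<^sub>0 laurent"

definition monomial_odd :: "gen_monoid \<Rightarrow> bool"
  where "monomial_odd u = odd (length (filter gen_odd (letters u)))"

definition free_hcomp :: "bool \<Rightarrow> free_alg \<Rightarrow> free_alg"
  where "free_hcomp s = Poly_Mapping.mapp (\<lambda>u r. if monomial_odd u = s then r else 0)"

definition free_const :: "laurent \<Rightarrow> free_alg"
  where "free_const r = Poly_Mapping.single 0 r"

definition free_gen :: "gen \<Rightarrow> free_alg"
  where "free_gen g = Poly_Mapping.single (Monomial [g]) 1"

text \<open>\<open>free_a i j\<close> is the generator in row \<open>i\<close> and column \<open>j\<close>, for indices from 1 to 6.\<close>

definition free_a :: "nat \<Rightarrow> nat \<Rightarrow> free_alg"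
  where "free_a i j = free_gen (Entry (Index i) (Index j))"

lemma lookup_free_hcomp:
  "Poly_Mapping.lookup (free_hcomp s f) u =
    (if monomial_odd u = s then Poly_Mapping.lookup f u else 0)"
  by (simp add: free_hcomp_def lookup_mapp when_def in_keys_iff)

lemma monomial_odd_zero [simp]: "\<not> monomial_odd 0"
  by (simp add: monomial_odd_def zero_gen_monoid.rep_eq)

lemma monomial_odd_add: "monomial_odd (u + v) \<longleftrightarrow> monomial_odd u \<noteq> monomial_odd v"
  by (simp add: monomial_odd_def plus_gen_monoid.rep_eq)

lemma free_hcomp_add: "free_hcomp s (f + g) = free_hcomp s f + free_hcomp s g"
  by (rule poly_mapping_eqI) (simp add: lookup_free_hcomp lookup_add)

lemma free_hcomp_single:
  "free_hcomp s (Poly_Mapping.single u r) =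
    (if monomial_odd u = s then Poly_Mapping.single u r else 0)"
  by (rule poly_mapping_eqI) (auto simp: lookup_free_hcomp lookup_single when_def)

lemma free_hcomp_zero [simp]: "free_hcomp s 0 = 0"
  by (rule poly_mapping_eqI) (simp add: lookup_free_hcomp)

lemma free_hcomp_uminus: "free_hcomp s (- f) = - free_hcomp s f"
  by (rule poly_mapping_eqI) (simp add: lookup_free_hcomp)

lemma free_hcomp_diff: "free_hcomp s (f - g) = free_hcomp s f - free_hcomp s g"
  by (rule poly_mapping_eqI) (simp add: lookup_free_hcomp lookup_minus)

lemma free_hcomp_hcomp: "free_hcomp s (free_hcomp t f) = (if s = t then free_hcomp t f else 0)"
  by (rule poly_mapping_eqI) (auto simp: lookup_free_hcomp)

lemma free_hcomp_sum: "free_hcomp False f + free_hcomp True f = f"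
  by (rule poly_mapping_eqI) (auto simp: lookup_free_hcomp lookup_add)

lemma free_hcomp_one: "free_hcomp s 1 = (if s then 0 else 1)"
  unfolding single_one[symmetric] free_hcomp_single by simp

lemma free_hcomp_mult:
  "free_hcomp s (f * g) =
    free_hcomp False f * free_hcomp s g + free_hcomp True f * free_hcomp (\<not> s) g"
proof (induction f rule: poly_mapping_additive_induct)
  case (add f f')
  then show ?case by (simp add: free_hcomp_add algebra_simps)
next
  case (single u r)
  show ?case
  proof (induction g rule: poly_mapping_additive_induct)
    case (add g g')
    then show ?case by (simp add: free_hcomp_add algebra_simps)
  next
    case (single v r')
    show ?case by (auto simp: mult_single free_hcomp_single monomial_odd_add)
  qed
qed

lemma free_const_add: "free_const (r + r') = free_const r + free_const r'"
  by (simp add: free_const_def single_add)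

lemma free_const_mult: "free_const (r * r') = free_const r * free_const r'"
  by (simp add: free_const_def mult_single)

lemma free_const_one [simp]: "free_const 1 = 1"
  by (simp add: free_const_def)

lemma free_const_central: "f * free_const r = free_const r * f"
  by (induction f rule: poly_mapping_additive_induct)
    (simp_all add: free_const_def mult_single algebra_simps)

lemma free_hcomp_const: "free_hcomp s (free_const r * f) = free_const r * free_hcomp s f"
  unfolding free_hcomp_mult by (simp add: free_const_def free_hcomp_single)

definition free_homogeneous :: "bool \<Rightarrow> free_alg \<Rightarrow> bool"
  where "free_homogeneous s f \<longleftrightarrow> free_hcomp s f = f"

lemma free_homogeneous_other:
  "free_homogeneous s f \<Longrightarrow> free_hcomp t f = (if s = t then f else 0)"
  by (metis free_hcomp_hcomp free_homogeneous_def)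

lemma free_homogeneous_mult:
  "free_homogeneous s f \<Longrightarrow> free_homogeneous t g \<Longrightarrow> free_homogeneous (s \<noteq> t) (f * g)"
  by (cases s; cases t)
    (simp_all add: free_homogeneous_def[of _ "f * g"] free_hcomp_mult
      free_homogeneous_other[of _ f] free_homogeneous_other[of _ g])

lemma free_homogeneous_const: "free_homogeneous s f \<Longrightarrow> free_homogeneous s (free_const r * f)"
  by (simp add: free_homogeneous_def free_hcomp_const)

lemma free_homogeneous_diff:
  "free_homogeneous s f \<Longrightarrow> free_homogeneous s g \<Longrightarrow> free_homogeneous s (f - g)"
  by (simp add: free_homogeneous_def free_hcomp_diff)

lemma free_homogeneous_gen: "free_homogeneous (gen_odd g) (free_gen g)"
  by (simp add: free_homogeneous_def free_gen_def free_hcomp_single monomial_odd_def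
      Monomial_inverse)

lemma free_homogeneous_a:
  "i \<in> {1..6} \<Longrightarrow> j \<in> {1..6} \<Longrightarrow> free_homogeneous (odd (entry_par i j)) (free_a i j)"
  using free_homogeneous_gen[of "Entry (Index i) (Index j)"]
  by (simp add: free_a_def Index_inverse)


section \<open>The quantum general linear supergroup\<close>

definition perm_length :: "(nat \<Rightarrow> nat) \<Rightarrow> nat"
  where "perm_length \<sigma> = card {(i, j). 1 \<le> i \<and> i < j \<and> j \<le> 4 \<and> \<sigma> j < \<sigma> i}"

text \<open>The coefficient in \<open>free_D1\<close> is the power of \<open>-q\<close> with exponent \<open>- perm_length \<sigma>\<close>.\<close>

definition free_D1 :: free_alg
  where "free_D1 = (\<Sum>\<sigma> | \<sigma> permutes {1..4}.
    free_const ((- qpow (- 1)) ^ perm_length \<sigma>) *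
      (free_a 1 (\<sigma> 1) * free_a 2 (\<sigma> 2) * free_a 3 (\<sigma> 3) * free_a 4 (\<sigma> 4)))"

definition free_D2 :: free_alg
  where "free_D2 = free_a 5 5 * free_a 6 6 - free_const (qpow 1) * (free_a 5 6 * free_a 6 5)"

inductive_set Mq_relations :: "free_alg set"
  where
    odd_square: "i \<in> {1..6} \<Longrightarrow> j \<in> {1..6} \<Longrightarrow> odd (entry_par i j) \<Longrightarrow>
      free_a i j * free_a i j \<in> Mq_relations"
  | row: "i \<in> {1..6} \<Longrightarrow> j \<in> {1..6} \<Longrightarrow> l \<in> {1..6} \<Longrightarrow> j < l \<Longrightarrow>
      free_a i j * free_a i l
        - free_const ((- 1) ^ (entry_par i j * entry_par i l) * qpow ((- 1) ^ (par i + 1)))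
          * (free_a i l * free_a i j) \<in> Mq_relations"
  | column: "i \<in> {1..6} \<Longrightarrow> j \<in> {1..6} \<Longrightarrow> k \<in> {1..6} \<Longrightarrow> i < k \<Longrightarrow>
      free_a i j * free_a k j
        - free_const ((- 1) ^ (entry_par i j * entry_par k j) * qpow ((- 1) ^ (par j + 1)))
          * (free_a k j * free_a i j) \<in> Mq_relations"
  | antidiagonal: "i \<in> {1..6} \<Longrightarrow> j \<in> {1..6} \<Longrightarrow> k \<in> {1..6} \<Longrightarrow> l \<in> {1..6} \<Longrightarrow>
      i < k \<and> j > l \<or> i > k \<and> j < l \<Longrightarrow>
      free_a i j * free_a k l
        - free_const ((- 1) ^ (entry_par i j * entry_par k l)) * (free_a k l * free_a i j)
        \<in> Mq_relations"
  | diagonal: "i \<in> {1..6} \<Longrightarrow> j \<in> {1..6} \<Longrightarrow> k \<in> {1..6} \<Longrightarrow> l \<in> {1..6} \<Longrightarrow>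
      i < k \<Longrightarrow> j < l \<Longrightarrow>
      free_a i j * free_a k l
        - free_const ((- 1) ^ (entry_par i j * entry_par k l)) * (free_a k l * free_a i j)
        - free_const ((- 1) ^ (par i * par j + par i * par k + par j * par k)
            * (qpow (- 1) - qpow 1))
          * (free_a k j * free_a i l) \<in> Mq_relations"

text \<open>Inverting the two determinants is the universal localization: even two-sided inverses are
  adjoined freely.\<close>

definition GLq_relations :: "free_alg set"
  where "GLq_relations = Mq_relations \<union>
    {free_D1 * free_gen Inv_D1 - 1, free_gen Inv_D1 * free_D1 - 1,
     free_D2 * free_gen Inv_D2 - 1, free_gen Inv_D2 * free_D2 - 1}"

lemma free_homogeneous_aa:
  "i \<in> {1..6} \<Longrightarrow> j \<in> {1..6} \<Longrightarrow> k \<in> {1..6} \<Longrightarrow> l \<in> {1..6} \<Longrightarrow>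
    free_homogeneous (odd (entry_par i j) \<noteq> odd (entry_par k l)) (free_a i j * free_a k l)"
  by (intro free_homogeneous_mult free_homogeneous_a)

lemma free_homogeneous_aa':
  "i \<in> {1..6} \<Longrightarrow> j \<in> {1..6} \<Longrightarrow> k \<in> {1..6} \<Longrightarrow> l \<in> {1..6} \<Longrightarrow>
    odd (par i + par j + par k + par l) = s \<Longrightarrow>
    free_homogeneous s (free_a i j * free_a k l)"
  using free_homogeneous_aa[of i j k l] by (auto simp: entry_par_def)

lemma Mq_relations_homogeneous: "x \<in> Mq_relations \<Longrightarrow> \<exists>s. free_homogeneous s x"
proof (induction rule: Mq_relations.induct)
  case (odd_square i j)
  then show ?case using free_homogeneous_aa by blast
next
  case (row i j l)
  then show ?case
    by (intro exI[of _ "odd (par i + par j + par i + par l)"] free_homogeneous_diff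
        free_homogeneous_const free_homogeneous_aa') (auto simp: ac_simps)
next
  case (column i j k)
  then show ?case
    by (intro exI[of _ "odd (par i + par j + par k + par j)"] free_homogeneous_diff
        free_homogeneous_const free_homogeneous_aa') (auto simp: ac_simps)
next
  case (antidiagonal i j k l)
  then show ?case
    by (intro exI[of _ "odd (par i + par j + par k + par l)"] free_homogeneous_diff
        free_homogeneous_const free_homogeneous_aa') (auto simp: ac_simps)
next
  case (diagonal i j k l)
  then show ?case
    by (intro exI[of _ "odd (par i + par j + par k + par l)"] free_homogeneous_diff
        free_homogeneous_const free_homogeneous_aa') (auto simp: ac_simps)
qed

lemma free_homogeneous_sum:
  "(\<And>x. x \<in> A \<Longrightarrow> free_homogeneous s (f x)) \<Longrightarrow> free_homogeneous s (sum f A)"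
  by (induction A rule: infinite_finite_induct) (auto simp: free_homogeneous_def free_hcomp_add)

lemma free_D1_even: "free_homogeneous False free_D1"
  unfolding free_D1_def
proof (intro free_homogeneous_sum free_homogeneous_const)
  fix \<sigma> assume "\<sigma> \<in> {\<sigma>. \<sigma> permutes {1..4::nat}}"
  then have *: "\<sigma> i \<in> {1..4}" if "i \<in> {1..4}" for i
    using that permutes_in_image[of \<sigma> "{1..4}" i] by blast
  have "free_homogeneous False (free_a i (\<sigma> i))" if "i \<in> {1..4}" for i
    using free_homogeneous_a[of i "\<sigma> i"] *[OF that] that by (simp add: entry_par_def par_def)
  then have a: "free_homogeneous False (free_a 1 (\<sigma> 1))" "free_homogeneous False (free_a 2 (\<sigma> 2))"
    "free_homogeneous False (free_a 3 (\<sigma> 3))" "free_homogeneous False (free_a 4 (\<sigma> 4))"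
    by simp_all
  show "free_homogeneous False
    (free_a 1 (\<sigma> 1) * free_a 2 (\<sigma> 2) * free_a 3 (\<sigma> 3) * free_a 4 (\<sigma> 4))"
    using free_homogeneous_mult[OF free_homogeneous_mult[OF free_homogeneous_mult[OF a(1,2)] a(3)] a(4)]
    by simp
qed

lemma free_D2_even: "free_homogeneous False free_D2"
  unfolding free_D2_def
  by (intro free_homogeneous_diff free_homogeneous_const free_homogeneous_aa')
    (auto simp: par_def)

lemma GLq_relations_homogeneous: "x \<in> GLq_relations \<Longrightarrow> \<exists>s. free_homogeneous s x"
proof -
  have one: "free_homogeneous False 1" by (simp add: free_homogeneous_def free_hcomp_one)
  have inv: "free_homogeneous False (free_gen Inv_D1)" "free_homogeneous False (free_gen Inv_D2)"
    using free_homogeneous_gen[of Inv_D1] free_homogeneous_gen[of Inv_D2] by simp_all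
  assume "x \<in> GLq_relations"
  then show ?thesis
    unfolding GLq_relations_def
    using Mq_relations_homogeneous
      free_homogeneous_diff[OF free_homogeneous_mult[OF free_D1_even inv(1), simplified] one]
      free_homogeneous_diff[OF free_homogeneous_mult[OF inv(1) free_D1_even, simplified] one]
      free_homogeneous_diff[OF free_homogeneous_mult[OF free_D2_even inv(2), simplified] one]
      free_homogeneous_diff[OF free_homogeneous_mult[OF inv(2) free_D2_even, simplified] one]
    by auto
qed

lemma GLq_ideal_graded:
  assumes "x \<in> ideal_gen GLq_relations"
  shows "free_hcomp s x \<in> ideal_gen GLq_relations"
proof (rule ideal_gen_graded[OF free_hcomp_add free_hcomp_mult _ assms])
  fix s x assume x: "x \<in> GLq_relations"
  then obtain t where "free_homogeneous t x" using GLq_relations_homogeneous by blast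
  then show "free_hcomp s x \<in> ideal_gen GLq_relations"
    using free_homogeneous_other[of t x s] x by (auto intro: ideal_gen.intros)
qed

quotient_type glq = free_alg / "\<lambda>x y. x - y \<in> ideal_gen GLq_relations"
  by (rule ideal_gen_equivp)

instantiation glq :: superalgebra
begin

lift_definition zero_glq :: glq is 0 .
lift_definition one_glq :: glq is 1 .
lift_definition plus_glq :: "glq \<Rightarrow> glq \<Rightarrow> glq" is "(+)" by (rule ideal_gen_cong_add)
lift_definition minus_glq :: "glq \<Rightarrow> glq \<Rightarrow> glq" is "(-)" by (rule ideal_gen_cong_diff)
lift_definition uminus_glq :: "glq \<Rightarrow> glq" is uminus by (rule ideal_gen_cong_uminus)
lift_definition times_glq :: "glq \<Rightarrow> glq \<Rightarrow> glq" is "(*)" by (rule ideal_gen_cong_mult)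
lift_definition scale_glq :: "laurent \<Rightarrow> glq \<Rightarrow> glq" is "\<lambda>r x. free_const r * x"
  unfolding right_diff_distrib[symmetric] by (rule ideal_gen.left)
lift_definition hcomp_glq :: "bool \<Rightarrow> glq \<Rightarrow> glq" is free_hcomp
  unfolding free_hcomp_diff[symmetric] by (rule GLq_ideal_graded)

instance
proof
  fix x y :: glq and r :: laurent and s t :: bool
  show "x * (r *\<^sub>q y) = r *\<^sub>q (x * y)"
  proof transfer
    fix r x y
    have "x * (free_const r * y) = free_const r * (x * y)"
      by (simp only: mult.assoc[symmetric] free_const_central)
    then show "x * (free_const r * y) - free_const r * (x * y) \<in> ideal_gen GLq_relations"
      by (simp add: ideal_gen.zero)
  qed
  show "hcomp (s \<noteq> t) (hcomp s x * hcomp t y) = hcomp s x * hcomp t y"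
  proof transfer
    fix s t x y
    have "free_homogeneous s (free_hcomp s x)" "free_homogeneous t (free_hcomp t y)"
      by (simp_all add: free_homogeneous_def free_hcomp_hcomp)
    from free_homogeneous_mult[OF this]
    show "free_hcomp (s \<noteq> t) (free_hcomp s x * free_hcomp t y)
        - free_hcomp s x * free_hcomp t y \<in> ideal_gen GLq_relations"
      by (simp add: free_homogeneous_def ideal_gen.zero)
  qed
qed (transfer; simp add: algebra_simps ideal_gen.zero free_const_add free_const_mult
    free_hcomp_add free_hcomp_const free_hcomp_hcomp free_hcomp_sum free_hcomp_one)+

end

lift_definition glq_a :: "nat \<Rightarrow> nat \<Rightarrow> glq" is free_a .
lift_definition glq_D1 :: glq is free_D1 .
lift_definition glq_D2 :: glq is free_D2 .

text \<open>\<open>S\<close> is the antipode of the Hopf superalgebra whose comultiplication and counit are the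
  matrix ones on the entries.\<close>

definition GLq_antipode :: "(glq \<Rightarrow> glq) \<Rightarrow> bool"
  where "GLq_antipode S \<longleftrightarrow> (\<exists>\<Delta> \<epsilon>. hopf_superalgebra \<Delta> \<epsilon> S \<and>
    (\<forall>i\<in>{1..6}. \<forall>j\<in>{1..6}. \<Delta> (glq_a i j) = (\<Sum>k=1..6. glq_a i k \<otimes> glq_a k j) \<and>
      \<epsilon> (glq_a i j) = (if i = j then 1 else 0)))"


section \<open>The quantum special linear supergroup\<close>

text \<open>The quantum Berezinian is \<open>glq_D1 * S glq_D2\<close> for the antipode \<open>S\<close>, which is unique: the
  comultiplication and the counit are determined by their values on the entries.\<close>

definition SLq_relations :: "glq set"
  where "SLq_relations = {glq_D1 * S glq_D2 - 1 | S. GLq_antipode S}"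

lemma glq_D_even: "homogeneous False glq_D1" "homogeneous False glq_D2"
  unfolding homogeneous_def
  using free_D1_even free_D2_even
  by (transfer; simp add: free_homogeneous_def ideal_gen.zero)+

lemma hcomp_diff: "hcomp s (x - y :: 'a::superalgebra) = hcomp s x - hcomp s y"
  using hcomp_add[of s "x - y" y] by simp

lemma hcomp_times:
  fixes x y :: "'a::superalgebra"
  shows "hcomp s (x * y) = hcomp False x * hcomp s y + hcomp True x * hcomp (\<not> s) y"
proof -
  have h: "hcomp s (hcomp t x * hcomp t' y) = (if s = (t \<noteq> t') then hcomp t x * hcomp t' y else 0)"
    for s t t'
    using homogeneous_mult[OF homogeneous_hcomp[of t x] homogeneous_hcomp[of t' y],
        THEN homogeneous_other, of s]
    by auto
  have "x * y = (hcomp False x + hcomp True x) * (hcomp False y + hcomp True y)"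
    by (simp add: hcomp_sum)
  also have "hcomp s \<dots> = hcomp False x * hcomp s y + hcomp True x * hcomp (\<not> s) y"
    by (cases s) (simp_all add: distrib_left distrib_right hcomp_add h)
  finally show ?thesis .
qed

lemma SLq_relations_even: "x \<in> SLq_relations \<Longrightarrow> homogeneous False x"
proof -
  assume "x \<in> SLq_relations"
  then obtain S where x: "x = glq_D1 * S glq_D2 - 1" and S: "GLq_antipode S"
    unfolding SLq_relations_def by blast
  have "homogeneous False (S glq_D2)"
    using S glq_D_even(2) unfolding GLq_antipode_def hopf_superalgebra_def homogeneous_def by metis
  from homogeneous_mult[OF glq_D_even(1) this] show ?thesis
    by (simp add: x homogeneous_def hcomp_diff hcomp_one)
qed

lemma SLq_ideal_graded:
  assumes "x \<in> ideal_gen SLq_relations"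
  shows "hcomp s x \<in> ideal_gen SLq_relations"
proof (rule ideal_gen_graded[where h = hcomp and R = SLq_relations and x = x and s = s])
  show "hcomp s x \<in> ideal_gen SLq_relations" if x: "x \<in> SLq_relations" for s x
    using homogeneous_other[OF SLq_relations_even[OF x], of s] x
    by (auto intro: ideal_gen.intros)
qed (rule hcomp_add hcomp_times assms)+

quotient_type slq = glq / "\<lambda>x y. x - y \<in> ideal_gen SLq_relations"
  by (rule ideal_gen_equivp)

lemma ideal_gen_scale: "x \<in> ideal_gen R \<Longrightarrow> r *\<^sub>q x \<in> ideal_gen R" for x :: "'a::superalgebra"
  using ideal_gen.left[of x R "r *\<^sub>q 1"] by (simp add: scale_mult_left)

instantiation slq :: superalgebra
begin

lift_definition zero_slq :: slq is 0 .
lift_definition one_slq :: slq is 1 .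
lift_definition plus_slq :: "slq \<Rightarrow> slq \<Rightarrow> slq" is "(+)" by (rule ideal_gen_cong_add)
lift_definition minus_slq :: "slq \<Rightarrow> slq \<Rightarrow> slq" is "(-)" by (rule ideal_gen_cong_diff)
lift_definition uminus_slq :: "slq \<Rightarrow> slq" is uminus by (rule ideal_gen_cong_uminus)
lift_definition times_slq :: "slq \<Rightarrow> slq \<Rightarrow> slq" is "(*)" by (rule ideal_gen_cong_mult)
lift_definition scale_slq :: "laurent \<Rightarrow> slq \<Rightarrow> slq" is scale
  unfolding cq.scale_right_diff_distrib[symmetric] by (rule ideal_gen_scale)
lift_definition hcomp_slq :: "bool \<Rightarrow> slq \<Rightarrow> slq" is hcomp
  unfolding hcomp_diff[symmetric] by (rule SLq_ideal_graded)

instance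
proof
  fix x y :: slq and s t :: bool
  show "hcomp (s \<noteq> t) (hcomp s x * hcomp t y) = hcomp s x * hcomp t y"
    by transfer (simp only: hcomp_mult ideal_gen.zero diff_self)
qed (transfer; simp add: algebra_simps ideal_gen.zero scale_right_distrib scale_left_distrib
    scale_scale scale_mult_left scale_mult_right hcomp_add hcomp_scale hcomp_hcomp hcomp_sum
    hcomp_one)+

end

lift_definition slq_a :: "nat \<Rightarrow> nat \<Rightarrow> slq" is glq_a .


section \<open>The quantum super Grassmannian\<close>

definition slq_D :: "nat \<Rightarrow> nat \<Rightarrow> slq"
  where "slq_D i j = (if i = j then slq_a i 1 * slq_a i 2
    else slq_a i 1 * slq_a j 2 - qpow (- 1) *\<^sub>q (slq_a i 2 * slq_a j 1))"

definition Grq :: "slq set"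
  where "Grq = generated_subalgebra
    ({slq_D i j | i j. 1 \<le> i \<and> i < j \<and> j \<le> 4} \<union>
     {slq_D i n | i n. i \<in> {1..4} \<and> n \<in> {5, 6}} \<union> {slq_D 5 5, slq_D 6 6, slq_D 5 6})"

end

theory Submission
  imports Defs
begin

text \<open>Write \<open>d k l = a\<^sub>k\<^sub>1 a\<^sub>l\<^sub>2 - q\<^sup>-\<^sup>1 a\<^sub>k\<^sub>2 a\<^sub>l\<^sub>1\<close> for all \<open>k\<close> and \<open>l\<close>. As columns 1 and 2 are even, the
  signs in \<open>\<Delta> (d i j)\<close> do not depend on the column, and \<open>\<Delta> (d i j)\<close> is the sum of the tensors
  \<open>\<plusminus> a\<^sub>i\<^sub>k a\<^sub>j\<^sub>l \<otimes> d k l\<close>. The Manin relations put every \<open>d k l\<close> in the Grassmannian: \<open>d k l\<close>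
  is a multiple of \<open>d l k\<close>, and \<open>d k k\<close> is \<open>0\<close> or a multiple of \<open>D\<^sub>k\<^sub>k\<close>. It remains to observe
  that the Grassmannian is graded, so that its tensor product with the whole algebra is closed
  under the super multiplication.\<close>

section \<open>Graded subalgebras and their tensor products\<close>

lemma pure_tensor_times: "(x \<otimes> y) * (z \<otimes> w) = tensor_mult_pure x y z w"
  unfolding times_tensor_def
  by (rule trans[OF tensor_lift_pure[OF bilinear_times]
        tensor_lift_pure[OF bilinear_tensor_mult_pure]])

lemma pure_tensor_diff_right: "x \<otimes> (y - y') = x \<otimes> y - x \<otimes> y'"
  using pure_tensor_add_right[of x "y - y'" y'] by simp

lemma pure_tensor_uminus: "(- x) \<otimes> y = - (x \<otimes> y)" "x \<otimes> (- y) = - (x \<otimes> y)"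
  using pure_tensor_scale_left[of "- 1" x y] pure_tensor_scale_right[of x "- 1" y]
  by (simp_all add: scale_one)

lemma subalgebra_generated_subalgebra: "subalgebra (generated_subalgebra X)"
  unfolding generated_subalgebra_def by (rule hull_in) (fastforce simp: subalgebra_def)

lemma generated_subalgebra_base: "x \<in> X \<Longrightarrow> x \<in> generated_subalgebra X"
  unfolding generated_subalgebra_def by (rule hull_inc)

lemma generated_subalgebra_minimal:
  "X \<subseteq> B \<Longrightarrow> subalgebra B \<Longrightarrow> generated_subalgebra X \<subseteq> B"
  unfolding generated_subalgebra_def by (rule hull_minimal)

lemma subalgebra_zero: "subalgebra B \<Longrightarrow> 0 \<in> B"
  unfolding subalgebra_def by (metis cq.scale_zero_left)

text \<open>The elements whose components all lie in the generated subalgebra themselves form a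
  subalgebra; it contains \<open>X\<close>, so minimality applies.\<close>

lemma generated_subalgebra_graded:
  assumes X: "\<And>x. x \<in> X \<Longrightarrow> \<exists>t. homogeneous t x"
    and x: "x \<in> generated_subalgebra X"
  shows "hcomp s x \<in> generated_subalgebra X"
proof -
  let ?B = "generated_subalgebra X"
  have B: "subalgebra ?B" by (rule subalgebra_generated_subalgebra)
  have "X \<subseteq> {x. \<forall>s. hcomp s x \<in> ?B}"
  proof
    fix x assume x: "x \<in> X"
    then obtain t where "homogeneous t x" using X by blast
    then show "x \<in> {x. \<forall>s. hcomp s x \<in> ?B}"
      using homogeneous_other[of t x] generated_subalgebra_base[OF x] subalgebra_zero[OF B] by simp
  qed
  moreover have "subalgebra {x. \<forall>s. hcomp s x \<in> ?B}"
    using B subalgebra_zero[OF B]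
    by (auto simp: subalgebra_def hcomp_add hcomp_scale hcomp_times
        homogeneous_other[OF homogeneous_one])
  ultimately have "?B \<subseteq> {x. \<forall>s. hcomp s x \<in> ?B}" by (rule generated_subalgebra_minimal)
  then show ?thesis using x by blast
qed

lemma tensor_subspace_pure: "x \<in> X \<Longrightarrow> y \<in> Y \<Longrightarrow> x \<otimes> y \<in> tensor_subspace X Y"
  unfolding tensor_subspace_def by (rule cq.span_base) blast

text \<open>The product of two pure tensors involves the components of the inner factors
  \<open>y\<close> and \<open>z\<close>, so closure rests on \<open>A\<close> and \<open>B\<close>
  being graded.\<close>

lemma subalgebra_tensor_subspace:
  fixes A :: "'a::superalgebra set" and B :: "'b::superalgebra set"
  assumes A: "subalgebra A" "\<And>s x. x \<in> A \<Longrightarrow> hcomp s x \<in> A"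
    and B: "subalgebra B" "\<And>s y. y \<in> B \<Longrightarrow> hcomp s y \<in> B"
  shows "subalgebra (tensor_subspace A B)"
proof -
  have pure: "(x \<otimes> y) * (z \<otimes> w) \<in> tensor_subspace A B"
    if "x \<in> A" "y \<in> B" "z \<in> A" "w \<in> B" for x y z w
  proof -
    have "x * hcomp t z \<in> A" "hcomp s y * w \<in> B" for s t
      using that A B by (simp_all add: subalgebra_def)
    then show ?thesis
      unfolding pure_tensor_times tensor_mult_pure_def tensor_subspace_def
      by (intro cq.span_sum cq.span_scale cq.span_base) blast
  qed
  have right: "(x \<otimes> y) * u \<in> tensor_subspace A B"
    if "u \<in> tensor_subspace A B" "x \<in> A" "y \<in> B" for x y u
    using that(1) unfolding tensor_subspace_def
  proof (induction rule: cq.span_induct_alt)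
    case base
    then show ?case by (simp add: cq.span_zero)
  next
    case (step r v w)
    then show ?case
      using pure[OF that(2,3)] unfolding tensor_subspace_def
      by (auto simp: distrib_left scale_mult_right intro!: cq.span_add cq.span_scale)
  qed
  have "t * u \<in> tensor_subspace A B"
    if t: "t \<in> tensor_subspace A B" and u: "u \<in> tensor_subspace A B" for t u
    using t unfolding tensor_subspace_def
  proof (induction rule: cq.span_induct_alt)
    case base
    then show ?case by (simp add: cq.span_zero)
  next
    case (step r v w)
    then show ?case
      using right[OF u] unfolding tensor_subspace_def
      by (auto simp: distrib_right scale_mult_left intro!: cq.span_add cq.span_scale)
  qed
  then show ?thesis
    using A B tensor_subspace_pure[of 1 A 1 B]
    by (auto simp: subalgebra_def one_tensor_def tensor_subspace_def cq.span_add cq.span_scale)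
qed

text \<open>Meant for double sums whose off-diagonal terms need not lie in \<open>T\<close> one by
  one, but do once \<open>(k, l)\<close> is paired with \<open>(l, k)\<close>.\<close>

lemma sum_sum_symmetric_mem:
  fixes f :: "'i::linorder \<Rightarrow> 'i \<Rightarrow> 'a::comm_monoid_add"
  assumes "finite A" and zero: "0 \<in> T" and add: "\<And>x y. x \<in> T \<Longrightarrow> y \<in> T \<Longrightarrow> x + y \<in> T"
    and diag: "\<And>k. k \<in> A \<Longrightarrow> f k k \<in> T"
    and off: "\<And>k l. k \<in> A \<Longrightarrow> l \<in> A \<Longrightarrow> k < l \<Longrightarrow> f k l + f l k \<in> T"
  shows "(\<Sum>k\<in>A. \<Sum>l\<in>A. f k l) \<in> T"
proof -
  have sum: "sum g I \<in> T" if "\<And>k. k \<in> I \<Longrightarrow> g k \<in> T" for g and I :: "'i set"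
    using that by (induction I rule: infinite_finite_induct) (auto intro: zero add)
  have off': "f k l + f l k \<in> T" if "k \<in> A" "l \<in> A" "k \<noteq> l" for k l
    using off[of k l] off[of l k] that by (cases "k < l") (auto simp: add.commute)
  have "B \<subseteq> A \<Longrightarrow> (\<Sum>k\<in>B. \<Sum>l\<in>B. f k l) \<in> T" if "finite B" for B
    using that
  proof (induction B)
    case empty
    then show ?case by (simp add: zero)
  next
    case (insert a B)
    have "(\<Sum>k\<in>insert a B. \<Sum>l\<in>insert a B. f k l) =
        f a a + (\<Sum>l\<in>B. f a l + f l a) + (\<Sum>k\<in>B. \<Sum>l\<in>B. f k l)"
      using insert.hyps by (simp add: sum.distrib ac_simps)
    also have "\<dots> \<in> T"
      using insert by (intro add sum diag insert.IH off') auto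
    finally show ?case .
  qed
  then show ?thesis using assms(1) by blast
qed

section \<open>The Manin relations in the special linear quotient\<close>

lemma qpow_mult: "qpow m * qpow n = qpow (m + n)"
  by (simp add: qpow_def mult_single)

lemma qpow_0: "qpow 0 = 1"
  by (simp add: qpow_def)

text \<open>Brings the signs of the Manin relations into the form used by the super
  multiplication.\<close>

lemma minus_one_power_koszul: "(- 1 :: laurent) ^ (m * n) = koszul (odd m) (odd n)"
  by (simp add: koszul_def)

lemma odd_par [simp]: "odd (par i) \<longleftrightarrow> 4 < i"
  by (simp add: par_def)

lemma odd_entry_par [simp]: "odd (entry_par i j) \<longleftrightarrow> (4 < i) \<noteq> (4 < j)"
  by (auto simp: entry_par_def par_def)

lemmas glq_abs = glq_a.abs_eq zero_glq.abs_eq minus_glq.abs_eq times_glq.abs_eq scale_glq.abs_eq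
  hcomp_glq.abs_eq
lemmas slq_abs = slq_a.abs_eq zero_slq.abs_eq minus_slq.abs_eq times_slq.abs_eq scale_slq.abs_eq
  hcomp_slq.abs_eq

lemma abs_glq_eqI: "x - y \<in> Mq_relations \<Longrightarrow> abs_glq x = abs_glq y"
  by (simp add: glq.abs_eq_iff GLq_relations_def ideal_gen.base)

lemma slq_odd_square:
  assumes "i \<in> {1..6}" "j \<in> {1..6}" "(4 < i) \<noteq> (4 < j)"
  shows "slq_a i j * slq_a i j = 0"
proof -
  have "glq_a i j * glq_a i j = 0"
    unfolding glq_abs using assms
    by (intro abs_glq_eqI) (simp add: Mq_relations.odd_square)
  then show ?thesis by (simp add: slq_abs)
qed

lemma slq_row:
  assumes "i \<in> {1..6}" "j \<in> {1..6}" "l \<in> {1..6}" "j < l"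
  shows "slq_a i j * slq_a i l =
    (koszul ((4 < i) \<noteq> (4 < j)) ((4 < i) \<noteq> (4 < l)) * qpow (if 4 < i then 1 else - 1)) *\<^sub>q
      (slq_a i l * slq_a i j)"
proof -
  have "glq_a i j * glq_a i l =
      ((- 1) ^ (entry_par i j * entry_par i l) * qpow ((- 1) ^ (par i + 1))) *\<^sub>q
        (glq_a i l * glq_a i j)"
    unfolding glq_abs by (intro abs_glq_eqI Mq_relations.row assms)
  from arg_cong[OF this, of abs_slq] show ?thesis
    by (simp add: slq_abs minus_one_power_koszul par_def)
qed

lemma slq_antidiagonal:
  assumes "i \<in> {1..6}" "j \<in> {1..6}" "k \<in> {1..6}" "l \<in> {1..6}"
    and "i < k \<and> j > l \<or> i > k \<and> j < l"
  shows "slq_a i j * slq_a k l =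
    koszul ((4 < i) \<noteq> (4 < j)) ((4 < k) \<noteq> (4 < l)) *\<^sub>q (slq_a k l * slq_a i j)"
proof -
  have "glq_a i j * glq_a k l =
      (- 1) ^ (entry_par i j * entry_par k l) *\<^sub>q (glq_a k l * glq_a i j)"
    unfolding glq_abs by (intro abs_glq_eqI Mq_relations.antidiagonal assms)
  from arg_cong[OF this, of abs_slq] show ?thesis
    by (simp add: slq_abs minus_one_power_koszul)
qed

text \<open>In even columns \<open>par j = 0\<close>, so both signs of the relation reduce to the
  one given by the parities of the rows.\<close>

lemma slq_diagonal:
  assumes "i \<in> {1..6}" "j \<in> {1..4}" "k \<in> {1..6}" "l \<in> {1..4}" "i < k" "j < l"
  shows "slq_a i j * slq_a k l - koszul (4 < i) (4 < k) *\<^sub>q (slq_a k l * slq_a i j) =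
    (koszul (4 < i) (4 < k) * (qpow (- 1) - qpow 1)) *\<^sub>q (slq_a k j * slq_a i l)"
proof -
  have jl: "j \<in> {1..6}" "l \<in> {1..6}" "par j = 0" "\<not> 4 < j" "\<not> 4 < l"
    using assms by (auto simp: par_def)
  have "glq_a i j * glq_a k l - (- 1) ^ (entry_par i j * entry_par k l) *\<^sub>q (glq_a k l * glq_a i j)
      = ((- 1) ^ (par i * par j + par i * par k + par j * par k) * (qpow (- 1) - qpow 1)) *\<^sub>q
        (glq_a k j * glq_a i l)"
    unfolding glq_abs by (intro abs_glq_eqI Mq_relations.diagonal assms jl)
  from arg_cong[OF this, of abs_slq] show ?thesis
    by (simp add: slq_abs minus_one_power_koszul jl)
qed

lemma homogeneous_slq_a:
  assumes "i \<in> {1..6}" "j \<in> {1..6}"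
  shows "homogeneous ((4 < i) \<noteq> (4 < j)) (slq_a i j)"
  using free_homogeneous_a[OF assms]
  by (simp add: homogeneous_def slq_abs glq_abs free_homogeneous_def)

section \<open>Minors on columns 1 and 2\<close>

definition slq_minor :: "nat \<Rightarrow> nat \<Rightarrow> slq"
  where "slq_minor k l = slq_a k 1 * slq_a l 2 - qpow (- 1) *\<^sub>q (slq_a k 2 * slq_a l 1)"

lemma slq_D_minor: "i \<noteq> j \<Longrightarrow> slq_D i j = slq_minor i j"
  by (simp add: slq_D_def slq_minor_def)

lemma koszul_commute: "koszul s t = koszul t s"
  by (auto simp: koszul_def)

text \<open>The row relation for columns 1 and 2 has coefficient \<open>qpow (- 1)\<close> in an
  even row, so the two terms cancel. In an odd row it is \<open>- qpow 1\<close>, so the second term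
  becomes \<open>qpow (- 2)\<close> times the first.\<close>

lemma slq_minor_diagonal:
  assumes "k \<in> {1..6}"
  shows "slq_minor k k = (if 4 < k then (1 + qpow (- 2)) *\<^sub>q slq_D k k else 0)"
proof (cases "4 < k")
  case True
  have "slq_a k 1 * slq_a k 2 = (- qpow 1) *\<^sub>q (slq_a k 2 * slq_a k 1)"
    using slq_row[of k 1 2] assms True by simp
  then have "(qpow (- 2)) *\<^sub>q (slq_a k 1 * slq_a k 2) =
      - (qpow (- 1) *\<^sub>q (slq_a k 2 * slq_a k 1))"
    by (simp add: scale_scale qpow_mult)
  then show ?thesis
    using True by (simp add: slq_minor_def slq_D_def scale_left_distrib scale_one)
next
  case False
  then show ?thesis
    using slq_row[of k 1 2] assms by (simp add: slq_minor_def)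
qed

lemma slq_minor_swap:
  assumes "k \<in> {1..6}" "l \<in> {1..6}" "l < k"
  shows "slq_minor k l = (- koszul (4 < k) (4 < l) * qpow (- 1)) *\<^sub>q slq_minor l k"
proof -
  let ?s = "koszul (4 < k) (4 < l)"
  let ?x = "slq_a k 1 * slq_a l 2" and ?y = "slq_a k 2 * slq_a l 1"
  have 1: "slq_a l 2 * slq_a k 1 = ?s *\<^sub>q ?x"
    using slq_antidiagonal[of l 2 k 1] assms by (simp add: koszul_commute)
  have 2: "slq_a l 1 * slq_a k 2 = ?s *\<^sub>q ?y + (?s * (qpow (- 1) - qpow 1)) *\<^sub>q ?x"
    using slq_diagonal[of l 1 k 2] assms by (simp add: koszul_commute algebra_simps)
  \<comment> \<open>The \<open>qpow (- 1)\<close> multiples of \<open>?x\<close> coming from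
    \<open>1\<close> and \<open>2\<close> cancel, which leaves \<open>- ?s * qpow 1\<close> times
    \<open>slq_minor k l\<close>; the sign \<open>?s\<close> squares to 1.\<close>
  have "slq_minor l k = ?s *\<^sub>q ?y - (?s * qpow 1) *\<^sub>q ?x"
    unfolding slq_minor_def 1 2
    by (simp add: scale_scale cq.scale_left_diff_distrib scale_left_distrib algebra_simps)
  then show ?thesis
    by (cases "4 < k \<and> 4 < l")
      (auto simp: koszul_def slq_minor_def scale_scale qpow_mult qpow_0 scale_one
        cq.scale_right_diff_distrib)
qed

lemma slq_minor_in_Grq:
  assumes "k \<in> {1..6}" "l \<in> {1..6}"
  shows "slq_minor k l \<in> Grq"
proof -
  have sub: "subalgebra Grq" unfolding Grq_def by (rule subalgebra_generated_subalgebra)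
  have less: "slq_minor k l \<in> Grq" if "k \<in> {1..6}" "l \<in> {1..6}" "k < l" for k l
  proof -
    \<comment> \<open>The cases match the three families of generators with distinct
      indices.\<close>
    have "l \<le> 4 \<or> k \<le> 4 \<and> l \<in> {5, 6} \<or> k = 5 \<and> l = 6" using that by auto
    then have "slq_D k l \<in> Grq"
      unfolding Grq_def using that by (intro generated_subalgebra_base) auto
    then show ?thesis using that by (simp add: slq_D_minor)
  qed
  have diag: "slq_D k k \<in> Grq" if "4 < k"
  proof -
    have "k = 5 \<or> k = 6" using that assms by auto
    then show ?thesis unfolding Grq_def by (intro generated_subalgebra_base) auto
  qed
  consider "k < l" | "k = l" | "l < k" by linarith
  then show ?thesis
  proof cases
    case 2
    then show ?thesis
      using slq_minor_diagonal[OF assms(1)] diag sub subalgebra_zero[OF sub]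
      by (auto simp: subalgebra_def)
  next
    case 3
    then show ?thesis
      using slq_minor_swap[OF assms 3] less[OF assms(2,1) 3] sub unfolding subalgebra_def by metis
  qed (use less assms in blast)
qed

section \<open>The grading of the Grassmannian\<close>

lemma homogeneous_diff: "homogeneous s x \<Longrightarrow> homogeneous s y \<Longrightarrow> homogeneous s (x - y)"
  by (simp add: homogeneous_def hcomp_diff)

lemma homogeneous_scale: "homogeneous s x \<Longrightarrow> homogeneous s (r *\<^sub>q x)"
  by (simp add: homogeneous_def hcomp_scale)

text \<open>Columns 1 and 2 are even, so each entry has the parity of its row and all terms have the
  same parity.\<close>

lemma homogeneous_slq_D:
  assumes "i \<in> {1..6}" "j \<in> {1..6}"
  shows "homogeneous ((4 < i) \<noteq> (4 < j)) (slq_D i j)"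
proof -
  have a: "homogeneous (4 < k) (slq_a k 1)" "homogeneous (4 < k) (slq_a k 2)"
    if "k \<in> {1..6}" for k
    using homogeneous_slq_a[OF that, of 1] homogeneous_slq_a[OF that, of 2] by simp_all
  show ?thesis
  proof (cases "i = j")
    case True
    then show ?thesis
      using homogeneous_mult[OF a[OF assms(2)]] by (simp add: slq_D_def)
  next
    case False
    then show ?thesis
      unfolding slq_D_def
      by (simp only: if_False, intro homogeneous_diff homogeneous_scale homogeneous_mult a assms)
  qed
qed

lemma Grq_graded: "x \<in> Grq \<Longrightarrow> hcomp s x \<in> Grq"
  unfolding Grq_def
proof (erule generated_subalgebra_graded[rotated])
  fix x assume "x \<in> {slq_D i j | i j. 1 \<le> i \<and> i < j \<and> j \<le> 4} \<union>
     {slq_D i n | i n. i \<in> {1..4} \<and> n \<in> {5, 6}} \<union> {slq_D 5 5, slq_D 6 6, slq_D 5 6}"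
  then obtain i j where "x = slq_D i j" "i \<in> {1..6}" "j \<in> {1..6}" by fastforce
  then show "\<exists>t. homogeneous t x" using homogeneous_slq_D by blast
qed

section \<open>Comultiplication on the Grassmannian\<close>

theorem proposition6p1:
  fixes \<Delta> :: "slq \<Rightarrow> (slq, slq) tensor"
  assumes "superalgebra_hom \<Delta>"
    and "\<And>i j. i \<in> {1..6} \<Longrightarrow> j \<in> {1..6} \<Longrightarrow>
      \<Delta> (slq_a i j) = (\<Sum>k=1..6. slq_a i k \<otimes> slq_a k j)"
  shows "\<Delta> ` Grq \<subseteq> tensor_subspace UNIV Grq"
proof -
  let ?T = "tensor_subspace UNIV Grq :: (slq, slq) tensor set"
  let ?I = "{1..6::nat}"
  let ?a = slq_a
  have Grq: "subalgebra Grq" unfolding Grq_def by (rule subalgebra_generated_subalgebra)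
  have T: "subalgebra ?T"
    by (rule subalgebra_tensor_subspace) (auto simp: Grq Grq_graded subalgebra_def[of UNIV])
  have add: "x + y \<in> ?T" if "x \<in> ?T" "y \<in> ?T" for x y
    using T that by (simp add: subalgebra_def)
  have scale: "r *\<^sub>q x \<in> ?T" if "x \<in> ?T" for r x
    using T that by (simp add: subalgebra_def)
  have sum: "sum f J \<in> ?T" if "\<And>k. k \<in> J \<Longrightarrow> f k \<in> ?T" for f and J :: "nat set"
    using that by (induction J rule: infinite_finite_induct) (auto intro: subalgebra_zero[OF T] add)
  have hom: "\<Delta> (x + y) = \<Delta> x + \<Delta> y" "\<Delta> (r *\<^sub>q x) = r *\<^sub>q \<Delta> x" "\<Delta> (x * y) = \<Delta> x * \<Delta> y" "\<Delta> 1 = 1"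
    for x y r
    using assms(1) by (simp_all add: superalgebra_hom_def)
  have hom_diff: "\<Delta> (x - y) = \<Delta> x - \<Delta> y" for x y
    using hom(1)[of "x - y" y] by simp
  \<comment> \<open>The Koszul sign of moving \<open>?a j l\<close> past \<open>?a k m\<close>. For
    \<open>m\<close> in \<open>{1, 2}\<close> the parity of \<open>?a k m\<close> is that of row
    \<open>k\<close>, so the sign is the same for both terms of a minor.\<close>
  define c where "c j k l = koszul (4 < k) ((4 < j) \<noteq> (4 < l))" for j k l :: nat
  have prod: "\<Delta> (?a i m * ?a j n) =
      (\<Sum>k\<in>?I. \<Sum>l\<in>?I. c j k l *\<^sub>q ((?a i k * ?a j l) \<otimes> (?a k m * ?a l n)))"
    if "i \<in> ?I" "j \<in> ?I" "m \<in> {1, 2}" "n \<in> {1, 2}" for i j m n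
  proof -
    have mn: "m \<in> ?I" "n \<in> ?I" "\<not> 4 < m" using that by auto
    have "(?a i k \<otimes> ?a k m) * (?a j l \<otimes> ?a l n) =
        c j k l *\<^sub>q ((?a i k * ?a j l) \<otimes> (?a k m * ?a l n))" if "k \<in> ?I" "l \<in> ?I" for k l
      using pure_tensor_mult[OF homogeneous_slq_a[OF that(1) mn(1)]
          homogeneous_slq_a[OF \<open>j \<in> ?I\<close> that(2)]] mn(3)
      by (simp add: c_def)
    then show ?thesis
      using that mn by (simp add: hom assms(2) sum_product)
  qed
  have minor: "\<Delta> (slq_minor i j) \<in> ?T" if "i \<in> ?I" "j \<in> ?I" for i j
  proof -
    \<comment> \<open>Both terms expand with the same signs and left factors, so the right factors
      combine into \<open>slq_minor k l\<close>.\<close>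
    have "\<Delta> (slq_minor i j) =
        (\<Sum>k\<in>?I. \<Sum>l\<in>?I. c j k l *\<^sub>q ((?a i k * ?a j l) \<otimes> slq_minor k l))"
      unfolding slq_minor_def hom_diff hom(2)
      using that
      by (simp add: prod pure_tensor_diff_right pure_tensor_scale_right cq.scale_sum_right
          cq.scale_right_diff_distrib sum_subtractf scale_scale mult.commute)
    also have "\<dots> \<in> ?T"
      by (intro sum scale tensor_subspace_pure slq_minor_in_Grq) auto
    finally show ?thesis .
  qed
  \<comment> \<open>\<open>slq_D i i\<close> is not a multiple of \<open>slq_minor i i\<close>, as \<open>1 + qpow (- 2)\<close> is not invertible;
    instead the row relations pair the summands \<open>(k, l)\<close> and \<open>(l, k)\<close> into a minor.\<close>
  have square: "\<Delta> (slq_D i i) \<in> ?T" if i: "i \<in> {5, 6}" for i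
  proof -
    have i': "i \<in> ?I" "4 < i" using i by auto
    let ?f = "\<lambda>k l. c i k l *\<^sub>q ((?a i k * ?a i l) \<otimes> (?a k 1 * ?a l 2))"
    \<comment> \<open>For odd \<open>k\<close> the right factor is the generator
      \<open>slq_D k k\<close>; for even \<open>k\<close> the entry \<open>?a i k\<close> is odd, so
      the left factor vanishes.\<close>
    have diag: "?f k k \<in> ?T" if k: "k \<in> ?I" for k
    proof (cases "4 < k")
      case True
      then have "k = 5 \<or> k = 6" using k by auto
      then have "slq_D k k \<in> Grq" unfolding Grq_def by (intro generated_subalgebra_base) auto
      then show ?thesis by (intro scale tensor_subspace_pure) (auto simp: slq_D_def)
    next
      case False
      then show ?thesis
        using slq_odd_square[OF i'(1) k] i'(2) subalgebra_zero[OF T] by simp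
    qed
    have off: "?f k l + ?f l k \<in> ?T" if kl: "k \<in> ?I" "l \<in> ?I" "k < l" for k l
    proof -
      let ?x = "?a i k * ?a i l"
      let ?r = "koszul (\<not> 4 < k) (\<not> 4 < l)" and ?s = "koszul (4 < k) (4 < l)"
      have 1: "?x = (?r * qpow 1) *\<^sub>q (?a i l * ?a i k)"
        using slq_row[OF i'(1) kl] i'(2) by simp
      have 2: "?a i l * ?a i k = (?r * qpow (- 1)) *\<^sub>q ?x"
        unfolding 1 by (simp add: scale_scale koszul_def qpow_mult qpow_0 scale_one)
      have 3: "?a l 1 * ?a k 2 = ?s *\<^sub>q (?a k 2 * ?a l 1)"
        using slq_antidiagonal[of l 1 k 2] kl by (simp add: koszul_commute)
      \<comment> \<open>After reordering, both summands have left factor \<open>?x\<close>. In all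
        four parity cases \<open>c i l k * ?r * ?s = - c i k l\<close>, which supplies the minus
        sign of the minor, while \<open>2\<close> supplies its \<open>qpow (- 1)\<close>.\<close>
      have "?f k l + ?f l k = c i k l *\<^sub>q (?x \<otimes> slq_minor k l)"
        unfolding 2 3 slq_minor_def
        by (cases "4 < k"; cases "4 < l")
          (simp_all add: c_def i'(2) pure_tensor_scale_left pure_tensor_scale_right scale_scale
            pure_tensor_uminus pure_tensor_diff_right cq.scale_right_diff_distrib scale_one)
      also have "\<dots> \<in> ?T"
        using kl by (intro scale tensor_subspace_pure slq_minor_in_Grq) auto
      finally show ?thesis .
    qed
    have "\<Delta> (slq_D i i) = (\<Sum>k\<in>?I. \<Sum>l\<in>?I. ?f k l)"
      using prod[OF i'(1) i'(1), of 1 2] by (simp add: slq_D_def)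
    also have "\<dots> \<in> ?T"
      by (rule sum_sum_symmetric_mem[where f = ?f,
            OF finite_atLeastAtMost subalgebra_zero[OF T] add diag off])
    finally show ?thesis .
  qed
  \<comment> \<open>Since \<open>\<Delta>\<close> is a homomorphism and \<open>?T\<close> a
    subalgebra, the preimage of \<open>?T\<close> is a subalgebra, and only generators need
    checking.\<close>
  have "Grq \<subseteq> {x. \<Delta> x \<in> ?T}"
    unfolding Grq_def
  proof (rule generated_subalgebra_minimal)
    show "subalgebra {x. \<Delta> x \<in> tensor_subspace UNIV (generated_subalgebra
      ({slq_D i j | i j. 1 \<le> i \<and> i < j \<and> j \<le> 4} \<union>
       {slq_D i n | i n. i \<in> {1..4} \<and> n \<in> {5, 6}} \<union> {slq_D 5 5, slq_D 6 6, slq_D 5 6}))}"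
      using T unfolding Grq_def[symmetric] by (simp add: subalgebra_def hom)
  qed (fold Grq_def, use minor square in \<open>auto simp: slq_D_minor\<close>)
  then show ?thesis by blast
qed

end
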